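(* Every inverse semigroup is an idempotent-separating extension of a presheaf of groups by a pseudogroup of transformations. Precisely: let $S$ be an inverse semigroup, let $\delta\colon S\to T_{E(S)}$ be its Munn representation, let $T=\delta(S)$ be its image and let $K=Z(E(S))$ be the centralizer of the idempotents of $S$. Then $\delta\colon S\to T$ is a surjective idempotent-separating homomorphism whose Kernel is $K$, the inverse semigroup $K$ is isomorphic to the semigroup of a presheaf of groups over a meet semilattice, and $T$ is a pseudogroup of transformations, namely an inverse subsemigroup of $\Gamma(E(S))$, where $E(S)$ carries the topology having the principal order ideals as a base.
   Context: An inverse semigroup is a (nonempty) semigroup $S$ in which every $s$ has a unique element $s^{-1}$ with $s=ss^{-1}s$, $s^{-1}=s^{-1}ss^{-1}$. $E(S)$ is its set of idempotents; it is a meet semilattice with $e\wedge f=ef$, and $e\le f$ iff $e=ef=fe$. For $e\in E(S)$ write $e^{\downarrow}=\{f\in E(S): f\le e\}$, the principal order ideal generated by $e$. $I(X)$ is the inverse semigroup of all partial bijections of a set $X$ under composition of partial functions. For a meet semilattice $E$, the Munn semigroup $T_E\subseteq I(E)$ is the inverse semigroup of all order isomorphisms between principal order ideals of $E$. The Munn representation $\delta\colon S\to T_{E(S)}$ sends $s$ to $\delta_s\colon (s^{-1}s)^{\downarrow}\to(ss^{-1})^{\downarrow}$, $\delta_s(e)=ses^{-1}$. $Z(E(S))$ is the set of elements of $S$ commuting with every idempotent of $S$. A homomorphism is idempotent-separating if it is injective on idempotents. The Kernel of a homomorphism $\theta\colon S\to T$ of inverse semigroups is the set of elements of $S$ mapped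 by $\theta$ to idempotents. For a topological space $X$, $\Gamma(X)$ is the inverse semigroup of all homeomorphisms between open subsets of $X$, under composition of partial functions. A presheaf of groups over a meet semilattice $E$ is a family of pairwise disjoint groups $G_e$ ($e\in E$) with group homomorphisms $\phi_{e,f}\colon G_e\to G_f$ for $e\ge f$ such that $\phi_{e,e}$ is the identity and $\phi_{f,g}\phi_{e,f}=\phi_{e,g}$ whenever $e\ge f\ge g$. Its semigroup is $\bigcup_e G_e$ with product $xy=\phi_{e,e\wedge f}(x)\,\phi_{f,e\wedge f}(y)$ for $x\in G_e$, $y\in G_f$. *)

theory Defs
  imports "HOL-Analysis.Analysis" "HOL-Algebra.Group"
begin

section \<open>Inverse semigroups\<close>

text \<open>The records of HOL-Algebra with a multiplication all carry a unit, hence a new one.\<close>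

record 'a semigrp = "'a partial_object" +
  sg_mult :: "'a \<Rightarrow> 'a \<Rightarrow> 'a" (infixl \<open>\<cdot>\<index>\<close> 70)

locale inverse_semigroup =
  fixes S :: "'a semigrp" (structure)
  assumes nonempty: "carrier S \<noteq> {}"
    and closed: "\<lbrakk>x \<in> carrier S; y \<in> carrier S\<rbrakk> \<Longrightarrow> x \<cdot> y \<in> carrier S"
    and assoc: "\<lbrakk>x \<in> carrier S; y \<in> carrier S; z \<in> carrier S\<rbrakk> \<Longrightarrow> (x \<cdot> y) \<cdot> z = x \<cdot> (y \<cdot> z)"
    and unique_inverse: "s \<in> carrier S \<Longrightarrow>
      \<exists>!t. t \<in> carrier S \<and> s = s \<cdot> t \<cdot> s \<and> t = t \<cdot> s \<cdot> t"

definition sinv :: "'a semigrp \<Rightarrow> 'a \<Rightarrow> 'a" where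
  "sinv S s = (THE t. t \<in> carrier S \<and> s = s \<cdot>\<^bsub>S\<^esub> t \<cdot>\<^bsub>S\<^esub> s \<and> t = t \<cdot>\<^bsub>S\<^esub> s \<cdot>\<^bsub>S\<^esub> t)"

definition idempotents :: "'a semigrp \<Rightarrow> 'a set" where
  "idempotents S = {e \<in> carrier S. e \<cdot>\<^bsub>S\<^esub> e = e}"

definition centralizer_of_idempotents :: "'a semigrp \<Rightarrow> 'a set" where
  "centralizer_of_idempotents S =
     {s \<in> carrier S. \<forall>e \<in> idempotents S. s \<cdot>\<^bsub>S\<^esub> e = e \<cdot>\<^bsub>S\<^esub> s}"

definition inverse_subsemigroup :: "'a semigrp \<Rightarrow> 'a semigrp \<Rightarrow> bool" where
  "inverse_subsemigroup H S \<longleftrightarrow> inverse_semigroup S \<and> carrier H \<subseteq> carrier S \<and> carrier H \<noteq> {} \<and>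
     (\<forall>x\<in>carrier H. \<forall>y\<in>carrier H. x \<cdot>\<^bsub>H\<^esub> y = x \<cdot>\<^bsub>S\<^esub> y \<and> x \<cdot>\<^bsub>S\<^esub> y \<in> carrier H) \<and>
     (\<forall>x\<in>carrier H. sinv S x \<in> carrier H)"

definition semigroup_hom :: "'a semigrp \<Rightarrow> 'b semigrp \<Rightarrow> ('a \<Rightarrow> 'b) set" where
  "semigroup_hom S T = {h. h \<in> carrier S \<rightarrow> carrier T \<and>
     (\<forall>x\<in>carrier S. \<forall>y\<in>carrier S. h (x \<cdot>\<^bsub>S\<^esub> y) = h x \<cdot>\<^bsub>T\<^esub> h y)}"

definition semigroup_iso :: "'a semigrp \<Rightarrow> 'b semigrp \<Rightarrow> ('a \<Rightarrow> 'b) set" where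
  "semigroup_iso S T = {h \<in> semigroup_hom S T. bij_betw h (carrier S) (carrier T)}"

definition idempotent_separating :: "'a semigrp \<Rightarrow> ('a \<Rightarrow> 'b) \<Rightarrow> bool" where
  "idempotent_separating S h \<longleftrightarrow> inj_on h (idempotents S)"

definition Kernel :: "'a semigrp \<Rightarrow> 'b semigrp \<Rightarrow> ('a \<Rightarrow> 'b) \<Rightarrow> 'a set" where
  "Kernel S T h = {s \<in> carrier S. h s \<in> idempotents T}"

definition idempotent_order :: "'a semigrp \<Rightarrow> 'a gorder" where
  "idempotent_order S = \<lparr>carrier = idempotents S, eq = (=),
     le = (\<lambda>e f. e = e \<cdot>\<^bsub>S\<^esub> f \<and> e = f \<cdot>\<^bsub>S\<^esub> e)\<rparr>"


section \<open>Partial bijections and the Munn representation\<close>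

definition symmetric_inverse_semigroup :: "'a set \<Rightarrow> ('a \<rightharpoonup> 'a) semigrp" where
  "symmetric_inverse_semigroup X =
     \<lparr>carrier = {f. dom f \<subseteq> X \<and> ran f \<subseteq> X \<and> inj_on f (dom f)}, sg_mult = (\<circ>\<^sub>m)\<rparr>"

definition principal_ideal :: "'a gorder \<Rightarrow> 'a \<Rightarrow> 'a set" where
  "principal_ideal L e = {f \<in> carrier L. f \<sqsubseteq>\<^bsub>L\<^esub> e}"

definition munn_semigroup :: "'a gorder \<Rightarrow> ('a \<rightharpoonup> 'a) semigrp" where
  "munn_semigroup L = (symmetric_inverse_semigroup (carrier L))\<lparr>carrier :=
     {f \<in> carrier (symmetric_inverse_semigroup (carrier L)).
        (\<exists>e\<in>carrier L. dom f = principal_ideal L e) \<and>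
        (\<exists>e\<in>carrier L. ran f = principal_ideal L e) \<and>
        (\<forall>x\<in>dom f. \<forall>y\<in>dom f. x \<sqsubseteq>\<^bsub>L\<^esub> y \<longleftrightarrow> the (f x) \<sqsubseteq>\<^bsub>L\<^esub> the (f y))}\<rparr>"

definition munn_rep :: "'a semigrp \<Rightarrow> 'a \<Rightarrow> ('a \<rightharpoonup> 'a)" where
  "munn_rep S s = (\<lambda>e.
     if e \<in> principal_ideal (idempotent_order S) (sinv S s \<cdot>\<^bsub>S\<^esub> s)
     then Some (s \<cdot>\<^bsub>S\<^esub> e \<cdot>\<^bsub>S\<^esub> sinv S s) else None)"


section \<open>Pseudogroups of transformations\<close>

definition partial_homeomorphisms :: "'a topology \<Rightarrow> ('a \<rightharpoonup> 'a) semigrp" where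
  "partial_homeomorphisms X = (symmetric_inverse_semigroup (topspace X))\<lparr>carrier :=
     {f \<in> carrier (symmetric_inverse_semigroup (topspace X)).
        openin X (dom f) \<and> openin X (ran f) \<and>
        homeomorphic_map (subtopology X (dom f)) (subtopology X (ran f)) (\<lambda>x. the (f x))}\<rparr>"

definition principal_ideal_topology :: "'a gorder \<Rightarrow> 'a topology" where
  "principal_ideal_topology L =
     topology (arbitrary union_of (\<lambda>U. \<exists>e\<in>carrier L. U = principal_ideal L e))"


section \<open>Presheaves of groups\<close>

locale presheaf_of_groups = lower_semilattice L
  for L :: "'i gorder" (structure) +
  fixes G :: "'i \<Rightarrow> 'g monoid" and \<phi> :: "'i \<Rightarrow> 'i \<Rightarrow> 'g \<Rightarrow> 'g"
  assumes groups: "e \<in> carrier L \<Longrightarrow> group (G e)"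
    and disjoint: "\<lbrakk>e \<in> carrier L; f \<in> carrier L; e \<noteq> f\<rbrakk> \<Longrightarrow> carrier (G e) \<inter> carrier (G f) = {}"
    and restr_hom: "\<lbrakk>e \<in> carrier L; f \<in> carrier L; f \<sqsubseteq> e\<rbrakk> \<Longrightarrow> \<phi> e f \<in> hom (G e) (G f)"
    and restr_id: "\<lbrakk>e \<in> carrier L; x \<in> carrier (G e)\<rbrakk> \<Longrightarrow> \<phi> e e x = x"
    and restr_comp: "\<lbrakk>e \<in> carrier L; f \<in> carrier L; g \<in> carrier L; f \<sqsubseteq> e; g \<sqsubseteq> f;
      x \<in> carrier (G e)\<rbrakk> \<Longrightarrow> \<phi> f g (\<phi> e f x) = \<phi> e g x"

definition presheaf_index :: "'i gorder \<Rightarrow> ('i \<Rightarrow> 'g monoid) \<Rightarrow> 'g \<Rightarrow> 'i" where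
  "presheaf_index L G x = (THE e. e \<in> carrier L \<and> x \<in> carrier (G e))"

definition presheaf_semigroup ::
  "'i gorder \<Rightarrow> ('i \<Rightarrow> 'g monoid) \<Rightarrow> ('i \<Rightarrow> 'i \<Rightarrow> 'g \<Rightarrow> 'g) \<Rightarrow> 'g semigrp" where
  "presheaf_semigroup L G \<phi> = \<lparr>carrier = (\<Union>e\<in>carrier L. carrier (G e)),
     sg_mult = (\<lambda>x y. let e = presheaf_index L G x; f = presheaf_index L G y; m = e \<sqinter>\<^bsub>L\<^esub> f
                      in \<phi> e m x \<otimes>\<^bsub>G m\<^esub> \<phi> f m y)\<rparr>"


section \<open>Well-definedness of the idempotent semilattice and its topology\<close>

context inverse_semigroup
begin

lemma inverse_eqI:
  assumes "s \<in> carrier S" "t \<in> carrier S" "u \<in> carrier S"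
    "s \<cdot> t \<cdot> s = s" "t \<cdot> s \<cdot> t = t" "s \<cdot> u \<cdot> s = s" "u \<cdot> s \<cdot> u = u"
  shows "t = u"
  using unique_inverse[OF assms(1)] assms by metis

lemma idempotent_mult_closed:
  assumes "e \<in> idempotents S" "f \<in> idempotents S"
  shows "e \<cdot> f \<in> idempotents S"
proof -
  have c: "e \<in> carrier S" "f \<in> carrier S" and i: "e \<cdot> e = e" "f \<cdot> f = f"
    using assms by (auto simp: idempotents_def)
  have i': "e \<cdot> (e \<cdot> z) = e \<cdot> z" "f \<cdot> (f \<cdot> z) = f \<cdot> z" if "z \<in> carrier S" for z
    using that c i by (metis assoc)+
  obtain x where x: "x \<in> carrier S" "e \<cdot> f \<cdot> x \<cdot> (e \<cdot> f) = e \<cdot> f" "x \<cdot> (e \<cdot> f) \<cdot> x = x"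
    using unique_inverse[of "e \<cdot> f"] closed c by metis
  have y: "f \<cdot> (x \<cdot> e) = x"
  proof (rule inverse_eqI[of "e \<cdot> f"])
    show "e \<cdot> f \<cdot> (f \<cdot> (x \<cdot> e)) \<cdot> (e \<cdot> f) = e \<cdot> f"
      using x(2) by (simp add: assoc closed c x(1) i i')
    have "f \<cdot> (x \<cdot> e) \<cdot> (e \<cdot> f) \<cdot> (f \<cdot> (x \<cdot> e)) = f \<cdot> (x \<cdot> (e \<cdot> f) \<cdot> x \<cdot> e)"
      by (simp add: assoc closed c x(1) i i')
    then show "f \<cdot> (x \<cdot> e) \<cdot> (e \<cdot> f) \<cdot> (f \<cdot> (x \<cdot> e)) = f \<cdot> (x \<cdot> e)"
      using x(3) by simp
  qed (use x c closed in auto)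
  have "x \<cdot> x = (f \<cdot> (x \<cdot> e)) \<cdot> (f \<cdot> (x \<cdot> e))" using y by simp
  also have "\<dots> = f \<cdot> (x \<cdot> (e \<cdot> f) \<cdot> x \<cdot> e)" by (simp add: assoc closed c x(1))
  also have "\<dots> = x" using x(3) y by simp
  finally have xx: "x \<cdot> x = x" .
  have "e \<cdot> f = x"
    by (rule inverse_eqI[of x]) (use x c closed xx in auto)
  then show ?thesis using xx x(1) by (simp add: idempotents_def)
qed

lemma idempotents_commute:
  assumes "e \<in> idempotents S" "f \<in> idempotents S"
  shows "e \<cdot> f = f \<cdot> e"
proof -
  have c: "e \<in> carrier S" "f \<in> carrier S" and i: "e \<cdot> e = e" "f \<cdot> f = f"
    using assms by (auto simp: idempotents_def)
  have i': "e \<cdot> (e \<cdot> z) = e \<cdot> z" "f \<cdot> (f \<cdot> z) = f \<cdot> z" if "z \<in> carrier S" for z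
    using that c i by (metis assoc)+
  have p: "e \<cdot> f \<cdot> (e \<cdot> f) = e \<cdot> f" "f \<cdot> e \<cdot> (f \<cdot> e) = f \<cdot> e"
    using idempotent_mult_closed assms by (auto simp: idempotents_def)
  have p': "e \<cdot> (f \<cdot> (e \<cdot> f)) = e \<cdot> f" "f \<cdot> (e \<cdot> (f \<cdot> e)) = f \<cdot> e"
    using p by (simp_all add: assoc closed c)
  show ?thesis
    by (rule inverse_eqI[of "e \<cdot> f"]) (use p p' in \<open>simp_all add: assoc closed c i i'\<close>)
qed

lemma greatest_lower_bound:
  assumes "e \<in> idempotents S" "f \<in> idempotents S"
  shows "greatest (idempotent_order S) (e \<cdot> f) (Lower (idempotent_order S) {e, f})"
proof -
  have c: "x \<in> carrier S" if "x \<in> idempotents S" for x using that by (auto simp: idempotents_def)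
  have i: "x \<cdot> x = x" if "x \<in> idempotents S" for x using that by (auto simp: idempotents_def)
  have ef: "e \<cdot> f \<in> idempotents S" using assms by (rule idempotent_mult_closed)
  have lower: "e \<cdot> f \<cdot> e = e \<cdot> f" "e \<cdot> (e \<cdot> f) = e \<cdot> f" "e \<cdot> f \<cdot> f = e \<cdot> f" "f \<cdot> (e \<cdot> f) = e \<cdot> f"
    using assms c i idempotents_commute assoc closed by metis+
  have great: "g = g \<cdot> (e \<cdot> f)" "g = e \<cdot> f \<cdot> g"
    if "g \<in> idempotents S" "g = g \<cdot> e" "g = g \<cdot> f" "g = e \<cdot> g" "g = f \<cdot> g" for g
    using assms c that assoc by metis+
  show ?thesis
    using assms ef lower great
    by (auto simp: greatest_def Lower_def idempotent_order_def)
qed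

lemma lower_semilattice_idempotents: "lower_semilattice (idempotent_order S)"
proof -
  have c: "x \<in> carrier S" if "x \<in> idempotents S" for x using that by (auto simp: idempotents_def)
  have t: "x = x \<cdot> z" "x = z \<cdot> x" if "x \<in> idempotents S" "y \<in> idempotents S" "z \<in> idempotents S"
    "x = x \<cdot> y" "x = y \<cdot> x" "y = y \<cdot> z" "y = z \<cdot> y" for x y z
    using that c assoc by metis+
  show ?thesis
  proof
    fix x y assume "x \<in> carrier (idempotent_order S)" "y \<in> carrier (idempotent_order S)"
    then show "\<exists>s. greatest (idempotent_order S) s (Lower (idempotent_order S) {x, y})"
      using greatest_lower_bound by (auto simp: idempotent_order_def)
  next
    fix x y z assume "x \<sqsubseteq>\<^bsub>idempotent_order S\<^esub> y" "y \<sqsubseteq>\<^bsub>idempotent_order S\<^esub> z"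
      "x \<in> carrier (idempotent_order S)" "y \<in> carrier (idempotent_order S)"
      "z \<in> carrier (idempotent_order S)"
    then show "x \<sqsubseteq>\<^bsub>idempotent_order S\<^esub> z"
      using t[of x y z] by (simp add: idempotent_order_def)
  qed (auto simp: idempotent_order_def idempotents_def)
qed

end

lemma openin_principal_ideal_topology:
  assumes "lower_semilattice L"
  shows "openin (principal_ideal_topology L) =
    arbitrary union_of (\<lambda>U. \<exists>e\<in>carrier L. U = principal_ideal L e)"
proof -
  interpret lower_semilattice L by fact
  have int: "principal_ideal L e \<inter> principal_ideal L f = principal_ideal L (e \<sqinter>\<^bsub>L\<^esub> f)"
    if "e \<in> carrier L" "f \<in> carrier L" for e f
  proof -
    have "x \<sqsubseteq>\<^bsub>L\<^esub> e \<and> x \<sqsubseteq>\<^bsub>L\<^esub> f \<longleftrightarrow> x \<sqsubseteq>\<^bsub>L\<^esub> e \<sqinter>\<^bsub>L\<^esub> f" if "x \<in> carrier L" for x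
      using that \<open>e \<in> carrier L\<close> \<open>f \<in> carrier L\<close>
      by (meson le_trans meet_closed meet_le meet_left meet_right)
    then show ?thesis by (auto simp: principal_ideal_def)
  qed
  show ?thesis
    unfolding principal_ideal_topology_def
    by (rule topology_inverse', rule istopology_base) (metis int meet_closed)
qed

lemma topspace_principal_ideal_topology:
  assumes "lower_semilattice L"
  shows "topspace (principal_ideal_topology L) = carrier L"
proof -
  interpret lower_semilattice L by fact
  let ?X = "principal_ideal_topology L"
  have "openin ?X (principal_ideal L e)" if "e \<in> carrier L" for e
    using that unfolding openin_principal_ideal_topology[OF assms]
    by (intro arbitrary_union_of_inc) blast
  then have "e \<in> topspace ?X" if "e \<in> carrier L" for e
    using that openin_subset[of ?X "principal_ideal L e"] by (auto simp: principal_ideal_def)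
  moreover have "topspace ?X \<subseteq> carrier L"
    using openin_topspace[of ?X] unfolding openin_principal_ideal_topology[OF assms]
    by (auto simp: union_of_def principal_ideal_def)
  ultimately show ?thesis by blast
qed

end

theory Submission
  imports Defs
begin

text \<open>
  For an idempotent \<open>x\<close> and any \<open>s\<close>, the conjugate \<open>s \<cdot> x \<cdot> s\<^sup>\<star>\<close> is again an idempotent, and
  conjugation is multiplicative on idempotents because they commute (\<open>conj_mult\<close>). Hence
  conjugation by \<open>s\<close> is an order isomorphism from the principal ideal of \<open>s\<^sup>\<star> \<cdot> s\<close> onto that of
  \<open>s \<cdot> s\<^sup>\<star>\<close>, with conjugation by \<open>s\<^sup>\<star>\<close> as its inverse (\<open>munn_rep_sinv\<close>). That products go to
  composites is clear for the values; that also the domains agree is \<open>below_conj_iff\<close>. So the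
  image of the Munn representation is a set of partial bijections closed under composition and
  inversion, and any such set is an inverse semigroup
  (\<open>inverse_semigroup_of_partial_bijections\<close>). An idempotent is recovered from its image as the
  maximum of the domain.

  The image of \<open>s\<close> is idempotent exactly if conjugation by \<open>s\<close> fixes everything below
  \<open>s\<^sup>\<star> \<cdot> s\<close>, which turns out to mean that \<open>s\<close> commutes with all idempotents
  (\<open>munn_rep_idempotent_iff\<close>). An element \<open>s\<close> of this centralizer satisfies
  \<open>s \<cdot> s\<^sup>\<star> = s\<^sup>\<star> \<cdot> s\<close>, so the centralizer splits into groups, one for each
  idempotent \<open>e = s\<^sup>\<star> \<cdot> s\<close>. Multiplication by a smaller idempotent \<open>f\<close> maps the group at \<open>e\<close> to
  the group at \<open>f\<close>. With these restriction maps the presheaf product is the given product, so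
  that the identity map is the required isomorphism (\<open>centralizer_iso_presheaf_semigroup\<close>).

  In the topology generated by the principal ideals the open sets are the lower sets, and an order
  isomorphism between lower sets preserves these in both directions. So it is a homeomorphism
  between open sets (\<open>munn_semigroup_subset_partial_homeomorphisms\<close>).
\<close>


section \<open>Semigroups of partial bijections\<close>

definition partial_inverse :: "('a \<rightharpoonup> 'b) \<Rightarrow> ('b \<rightharpoonup> 'a)" where
  "partial_inverse f y = (if y \<in> ran f then Some (THE x. f x = Some y) else None)"

definition partial_image :: "('a \<rightharpoonup> 'b) \<Rightarrow> 'a set \<Rightarrow> 'b set" where
  "partial_image f U = {y. \<exists>x\<in>U. f x = Some y}"

lemma inj_on_dom_eqI:
  assumes "inj_on f (dom f)" "f x = Some y" "f x' = Some y"
  shows "x = x'"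
  by (rule inj_onD[OF assms(1)]) (use assms in auto)

lemma partial_inverse_eq_Some_iff:
  assumes "inj_on f (dom f)"
  shows "partial_inverse f y = Some x \<longleftrightarrow> f x = Some y"
proof -
  have "(THE x'. f x' = Some y) = x'" if "f x' = Some y" for x'
    using that inj_on_dom_eqI[OF assms] by blast
  then show ?thesis
    by (auto simp: partial_inverse_def ran_def)
qed

lemma partial_inverseI:
  assumes "\<And>x y. f x = Some y \<longleftrightarrow> g y = Some x"
  shows "inj_on f (dom f)" and "partial_inverse f = g"
proof -
  show inj: "inj_on f (dom f)"
  proof (rule inj_onI)
    fix x x' assume "x \<in> dom f" "x' \<in> dom f" "f x = f x'"
    then obtain y where "f x = Some y" "f x' = Some y" by auto
    then show "x = x'" using assms by fastforce
  qed
  show "partial_inverse f = g"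
  proof
    fix y
    show "partial_inverse f y = g y"
      using partial_inverse_eq_Some_iff[OF inj, of y] assms[of _ y]
      by (metis not_Some_eq)
  qed
qed

lemma inj_on_partial_inverse:
  assumes "inj_on f (dom f)"
  shows "inj_on (partial_inverse f) (dom (partial_inverse f))"
    and "partial_inverse (partial_inverse f) = f"
  by (rule partial_inverseI, rule partial_inverse_eq_Some_iff[OF assms])+

lemma dom_partial_inverse: "dom (partial_inverse f) = ran f"
  by (auto simp: partial_inverse_def split: if_splits)

lemma ran_partial_inverse:
  assumes "inj_on f (dom f)"
  shows "ran (partial_inverse f) = dom f"
  using dom_partial_inverse[of "partial_inverse f"] inj_on_partial_inverse(2)[OF assms] by simp

lemma inj_on_map_comp:
  assumes "inj_on f (dom f)" "inj_on g (dom g)"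
  shows "inj_on (f \<circ>\<^sub>m g) (dom (f \<circ>\<^sub>m g))"
proof (rule inj_onI)
  fix x x' assume "x \<in> dom (f \<circ>\<^sub>m g)" "x' \<in> dom (f \<circ>\<^sub>m g)" "(f \<circ>\<^sub>m g) x = (f \<circ>\<^sub>m g) x'"
  then obtain v where "(f \<circ>\<^sub>m g) x = Some v" "(f \<circ>\<^sub>m g) x' = Some v" by auto
  then obtain u u' where g: "g x = Some u" "g x' = Some u'" and f: "f u = Some v" "f u' = Some v"
    unfolding map_comp_Some_iff by blast
  have "u = u'" by (rule inj_on_dom_eqI[OF assms(1) f])
  with g(2) have "g x' = Some u" by simp
  then show "x = x'" by (rule inj_on_dom_eqI[OF assms(2) g(1)])
qed

lemma partial_inverse_map_comp:
  assumes "inj_on f (dom f)" "inj_on g (dom g)"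
  shows "partial_inverse (f \<circ>\<^sub>m g) = partial_inverse g \<circ>\<^sub>m partial_inverse f"
  by (rule partial_inverseI(2))
    (auto simp add: map_comp_Some_iff partial_inverse_eq_Some_iff[OF assms(1)]
      partial_inverse_eq_Some_iff[OF assms(2)])

text \<open>
  The equation for \<open>f\<close> makes \<open>g\<close> extend the inverse of \<open>f\<close>, by injectivity of \<open>f\<close>; exchanging the
  roles of \<open>f\<close> and \<open>g\<close> gives the converse inclusion.
\<close>

lemma partial_inverse_unique:
  assumes "inj_on f (dom f)" "inj_on g (dom g)" "f = f \<circ>\<^sub>m g \<circ>\<^sub>m f" "g = g \<circ>\<^sub>m f \<circ>\<^sub>m g"
  shows "g = partial_inverse f"
proof -
  have key: "q y = Some x"
    if inj: "inj_on p (dom p)" and eq: "p = p \<circ>\<^sub>m q \<circ>\<^sub>m p" and y: "p x = Some y"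
    for p :: "'x \<rightharpoonup> 'y" and q x y
  proof -
    have "(p \<circ>\<^sub>m q \<circ>\<^sub>m p) x = Some y" using fun_cong[OF eq, of x] y by simp
    then obtain x' where x': "q y = Some x'" "p x' = Some y"
      using y by (auto simp: map_comp_Some_iff)
    show ?thesis using x' inj_on_dom_eqI[OF inj x'(2) y] by simp
  qed
  have "f x = Some y \<longleftrightarrow> g y = Some x" for x y
    using key[OF assms(1,3), of x y] key[OF assms(2,4), of y x] by (rule iffI)
  then show ?thesis by (rule partial_inverseI(2)[symmetric])
qed

text \<open>
  Both semigroups of maps in the theorem, the image of the Munn representation and the
  homeomorphisms between open subsets, are recognised by this criterion. Associativity is free, and
  a semigroup inverse of a partial bijection can only be the inverse partial bijection.
\<close>

lemma inverse_semigroup_of_partial_bijections: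
  assumes mult: "sg_mult H = (\<circ>\<^sub>m)" and ne: "carrier H \<noteq> {}"
    and inj: "\<And>f. f \<in> carrier H \<Longrightarrow> inj_on f (dom f)"
    and comp: "\<And>f g. f \<in> carrier H \<Longrightarrow> g \<in> carrier H \<Longrightarrow> f \<circ>\<^sub>m g \<in> carrier H"
    and inv: "\<And>f. f \<in> carrier H \<Longrightarrow> partial_inverse f \<in> carrier H"
  shows "inverse_semigroup H"
    and "f \<in> carrier H \<Longrightarrow> sinv H f = partial_inverse f"
proof -
  have ex: "f = f \<circ>\<^sub>m partial_inverse f \<circ>\<^sub>m f" if "inj_on f (dom f)" for f :: "'a \<rightharpoonup> 'a"
  proof
    fix x show "f x = (f \<circ>\<^sub>m partial_inverse f \<circ>\<^sub>m f) x"
    proof (cases "f x")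
      case (Some y)
      then have "partial_inverse f y = Some x" by (simp add: partial_inverse_eq_Some_iff[OF that])
      then show ?thesis using Some by (simp add: map_comp_def)
    qed (simp add: map_comp_def)
  qed
  have inverse_iff: "t \<in> carrier H \<and> f = f \<cdot>\<^bsub>H\<^esub> t \<cdot>\<^bsub>H\<^esub> f \<and> t = t \<cdot>\<^bsub>H\<^esub> f \<cdot>\<^bsub>H\<^esub> t
      \<longleftrightarrow> t = partial_inverse f" (is "?L \<longleftrightarrow> ?R") if f: "f \<in> carrier H" for f t
  proof
    assume ?L
    then show ?R using partial_inverse_unique[of f t] inj f mult by simp
  next
    assume t: ?R
    show ?L
      using ex[OF inj[OF f]] ex[OF inj[OF inv[OF f]]] inv[OF f]
        inj_on_partial_inverse(2)[OF inj[OF f]]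
      unfolding t mult by simp
  qed
  show "inverse_semigroup H"
  proof
    fix f g h :: "'a \<rightharpoonup> 'a"
    show "f \<cdot>\<^bsub>H\<^esub> g \<cdot>\<^bsub>H\<^esub> h = f \<cdot>\<^bsub>H\<^esub> (g \<cdot>\<^bsub>H\<^esub> h)"
      unfolding mult by (rule ext) (simp add: map_comp_def split: option.splits)
  qed (use ne comp mult inverse_iff in auto)
  show "sinv H f = partial_inverse f" if "f \<in> carrier H"
    using inverse_iff[OF that] by (simp add: sinv_def)
qed


section \<open>Pseudogroups of partial homeomorphisms\<close>

lemma partial_image_map_comp: "partial_image (f \<circ>\<^sub>m g) U = partial_image f (partial_image g U)"
  by (auto simp: partial_image_def map_comp_Some_iff)

text \<open>
  Unlike the conditions with subspace topologies, this description is visibly stable under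
  composition and inversion.
\<close>

lemma partial_homeomorphisms_iff:
  "f \<in> carrier (partial_homeomorphisms X) \<longleftrightarrow>
     dom f \<subseteq> topspace X \<and> ran f \<subseteq> topspace X \<and> inj_on f (dom f) \<and>
     (\<forall>U. openin X U \<longrightarrow> openin X (partial_image f U)) \<and>
     (\<forall>U. openin X U \<longrightarrow> openin X (partial_image (partial_inverse f) U))"
  (is "_ \<longleftrightarrow> ?R")
proof -
  define g where "g = (\<lambda>x. the (f x))"
  have image: "partial_image f U = g ` (U \<inter> dom f)" for U
    by (force simp: partial_image_def g_def dom_def)
  have preimage: "partial_image (partial_inverse f) U = {x \<in> dom f. g x \<in> U}"
    if "inj_on f (dom f)" for U
    by (auto simp: partial_image_def partial_inverse_eq_Some_iff[OF that] g_def)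
  have inj: "inj_on f (dom f) \<Longrightarrow> inj_on g (dom f)"
    by (force simp: g_def intro!: inj_onI dest: inj_on_dom_eqI)
  have ran: "g ` dom f = ran f"
    by (force simp: g_def ran_def dom_def)
  have unfold: "f \<in> carrier (partial_homeomorphisms X) \<longleftrightarrow>
     dom f \<subseteq> topspace X \<and> ran f \<subseteq> topspace X \<and> inj_on f (dom f) \<and>
     openin X (dom f) \<and> openin X (ran f) \<and>
     homeomorphic_map (subtopology X (dom f)) (subtopology X (ran f)) g"
    by (auto simp: partial_homeomorphisms_def symmetric_inverse_semigroup_def g_def)
  show ?thesis
  proof
    assume "f \<in> carrier (partial_homeomorphisms X)"
    then have f: "dom f \<subseteq> topspace X" "ran f \<subseteq> topspace X" "inj_on f (dom f)"
      and op: "openin X (dom f)" "openin X (ran f)"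
      and hom: "homeomorphic_map (subtopology X (dom f)) (subtopology X (ran f)) g"
      unfolding unfold by auto
    have "openin X (partial_image f U)" if "openin X U" for U
    proof -
      have "openin (subtopology X (dom f)) (U \<inter> dom f)"
        using that by (auto simp: openin_subtopology)
      then have "openin (subtopology X (ran f)) (g ` (U \<inter> dom f))"
        using homeomorphic_imp_open_map[OF hom] by (auto simp: open_map_def)
      then show ?thesis
        using op by (simp add: image openin_open_subtopology)
    qed
    moreover have "openin X (partial_image (partial_inverse f) U)" if "openin X U" for U
    proof -
      have "openin (subtopology X (ran f)) (U \<inter> ran f)"
        using that by (auto simp: openin_subtopology)
      then have "openin (subtopology X (dom f)) {x \<in> topspace (subtopology X (dom f)). g x \<in> U \<inter> ran f}"
        using homeomorphic_imp_continuous_map[OF hom] openin_continuous_map_preimage by blast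
      moreover have "{x \<in> topspace (subtopology X (dom f)). g x \<in> U \<inter> ran f} = {x \<in> dom f. g x \<in> U}"
        using f by (auto simp flip: ran)
      ultimately show ?thesis
        using op f by (simp add: preimage openin_open_subtopology)
    qed
    ultimately show ?R using f by blast
  next
    assume R: ?R
    then have f: "dom f \<subseteq> topspace X" "ran f \<subseteq> topspace X" "inj_on f (dom f)"
      and im: "\<And>U. openin X U \<Longrightarrow> openin X (partial_image f U)"
      and pre: "\<And>U. openin X U \<Longrightarrow> openin X (partial_image (partial_inverse f) U)" by auto
    have op: "openin X (dom f)" "openin X (ran f)"
    proof -
      have "partial_image (partial_inverse f) (topspace X) = dom f"
        using f imageI[of _ "dom f" g] unfolding preimage[OF f(3)] ran by blast
      then show "openin X (dom f)" using pre[of "topspace X"] by simp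
      have "partial_image f (topspace X) = ran f"
        using f ran by (simp add: image Int_absorb1)
      then show "openin X (ran f)" using im[of "topspace X"] by simp
    qed
    have "homeomorphic_map (subtopology X (dom f)) (subtopology X (ran f)) g"
    proof (rule bijective_open_imp_homeomorphic_map)
      show "continuous_map (subtopology X (dom f)) (subtopology X (ran f)) g"
        unfolding continuous_map_def
      proof (intro conjI allI impI)
        show "g \<in> topspace (subtopology X (dom f)) \<rightarrow> topspace (subtopology X (ran f))"
          using f imageI[of _ "dom f" g] unfolding ran by auto
        fix U assume "openin (subtopology X (ran f)) U"
        then have "openin X {x \<in> dom f. g x \<in> U}"
          using pre[of U] f op by (simp add: preimage openin_open_subtopology)
        moreover have "{x \<in> topspace (subtopology X (dom f)). g x \<in> U} = {x \<in> dom f. g x \<in> U}"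
          using f by auto
        ultimately show "openin (subtopology X (dom f)) {x \<in> topspace (subtopology X (dom f)). g x \<in> U}"
          using op by (simp add: openin_open_subtopology Collect_restrict)
      qed
      show "open_map (subtopology X (dom f)) (subtopology X (ran f)) g"
        unfolding open_map_def
      proof (intro allI impI)
        fix U assume "openin (subtopology X (dom f)) U"
        then have U: "openin X U" "U \<subseteq> dom f"
          using op by (simp_all add: openin_open_subtopology)
        then have "openin X (g ` U)" using im[of U] by (simp add: image Int_absorb2)
        moreover have "g ` U \<subseteq> ran f" using U ran by blast
        ultimately show "openin (subtopology X (ran f)) (g ` U)"
          using op by (simp add: openin_open_subtopology)
      qed
    qed (use f ran inj in \<open>simp_all add: Int_absorb1\<close>)
    then show "f \<in> carrier (partial_homeomorphisms X)"
      unfolding unfold using f op by blast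
  qed
qed

lemma partial_homeomorphisms_inverse_semigroup:
  shows "inverse_semigroup (partial_homeomorphisms X)"
    and "f \<in> carrier (partial_homeomorphisms X) \<Longrightarrow>
      sinv (partial_homeomorphisms X) f = partial_inverse f"
proof -
  let ?H = "partial_homeomorphisms X"
  have mult: "sg_mult ?H = (\<circ>\<^sub>m)"
    by (simp add: partial_homeomorphisms_def symmetric_inverse_semigroup_def)
  have "Map.empty \<in> carrier ?H"
    by (simp add: partial_homeomorphisms_iff partial_image_def partial_inverse_def)
  then have ne: "carrier ?H \<noteq> {}" by blast
  have inj: "inj_on f (dom f)" if "f \<in> carrier ?H" for f
    using that by (simp add: partial_homeomorphisms_iff)
  have comp: "f \<circ>\<^sub>m g \<in> carrier ?H" if "f \<in> carrier ?H" "g \<in> carrier ?H" for f g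
  proof -
    have "dom (f \<circ>\<^sub>m g) \<subseteq> dom g" "ran (f \<circ>\<^sub>m g) \<subseteq> ran f"
      by (auto simp: map_comp_Some_iff ran_def)
    then show ?thesis
      using that order.trans[of "dom (f \<circ>\<^sub>m g)" "dom g" "topspace X"]
        order.trans[of "ran (f \<circ>\<^sub>m g)" "ran f" "topspace X"]
      by (simp add: partial_homeomorphisms_iff inj_on_map_comp partial_image_map_comp
          partial_inverse_map_comp)
  qed
  have inv: "partial_inverse f \<in> carrier ?H" if "f \<in> carrier ?H" for f
    using that inj_on_partial_inverse(1)[of f]
    by (simp add: partial_homeomorphisms_iff dom_partial_inverse ran_partial_inverse
        inj_on_partial_inverse(2))
  show "inverse_semigroup ?H"
    by (rule inverse_semigroup_of_partial_bijections(1)) (fact mult ne inj comp inv)+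
  show "sinv ?H f = partial_inverse f" if "f \<in> carrier ?H"
    by (rule inverse_semigroup_of_partial_bijections(2)) (fact mult ne inj comp inv that)+
qed


section \<open>The Munn semigroup as a pseudogroup\<close>

text \<open>
  Every lower set is the union of the principal ideals of its members, so the open sets do not
  refer to the base any more.
\<close>

lemma openin_principal_ideal_topology_iff:
  assumes "lower_semilattice L"
  shows "openin (principal_ideal_topology L) U \<longleftrightarrow>
    U \<subseteq> carrier L \<and> (\<forall>y\<in>U. \<forall>x\<in>carrier L. x \<sqsubseteq>\<^bsub>L\<^esub> y \<longrightarrow> x \<in> U)" (is "_ \<longleftrightarrow> ?R")
proof -
  interpret lower_semilattice L by fact
  let ?B = "\<lambda>U. \<exists>e\<in>carrier L. U = principal_ideal L e"
  show ?thesis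
    unfolding openin_principal_ideal_topology[OF assms]
  proof
    assume "(arbitrary union_of ?B) U"
    then obtain \<B> where B: "\<And>V. V \<in> \<B> \<Longrightarrow> ?B V" "\<Union>\<B> = U"
      by (auto simp: union_of_def)
    have "V \<subseteq> carrier L \<and> (\<forall>y\<in>V. \<forall>x\<in>carrier L. x \<sqsubseteq>\<^bsub>L\<^esub> y \<longrightarrow> x \<in> V)" if "V \<in> \<B>" for V
    proof -
      obtain e where "e \<in> carrier L" "V = principal_ideal L e" using B(1) \<open>V \<in> \<B>\<close> by blast
      then show ?thesis using le_trans[of _ _ e] by (auto simp: principal_ideal_def)
    qed
    then show ?R using B(2) by blast
  next
    assume R: ?R
    have "U = \<Union>(principal_ideal L ` U)"
      using R by (force simp: principal_ideal_def)
    moreover have "(arbitrary union_of ?B) (\<Union>(principal_ideal L ` U))"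
      using R by (intro arbitrary_union_of_Union) (blast intro: arbitrary_union_of_inc)
    ultimately show "(arbitrary union_of ?B) U" by metis
  qed
qed

lemma munn_semigroup_iff:
  "f \<in> carrier (munn_semigroup L) \<longleftrightarrow>
     dom f \<subseteq> carrier L \<and> ran f \<subseteq> carrier L \<and> inj_on f (dom f) \<and>
     (\<exists>e\<in>carrier L. dom f = principal_ideal L e) \<and> (\<exists>e\<in>carrier L. ran f = principal_ideal L e) \<and>
     (\<forall>x y x' y'. f x = Some x' \<longrightarrow> f y = Some y' \<longrightarrow> (x \<sqsubseteq>\<^bsub>L\<^esub> y \<longleftrightarrow> x' \<sqsubseteq>\<^bsub>L\<^esub> y'))"
  by (auto simp: munn_semigroup_def symmetric_inverse_semigroup_def dom_def)

lemma partial_inverse_in_munn_semigroup: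
  assumes "f \<in> carrier (munn_semigroup L)"
  shows "partial_inverse f \<in> carrier (munn_semigroup L)"
proof -
  have inj: "inj_on f (dom f)" using assms by (simp add: munn_semigroup_iff)
  show ?thesis
    using assms inj_on_partial_inverse(1)[OF inj] unfolding munn_semigroup_iff
    by (auto simp: dom_partial_inverse ran_partial_inverse[OF inj]
        partial_inverse_eq_Some_iff[OF inj])
qed

text \<open>
  An order isomorphism between lower sets carries lower sets to lower sets: a point below an image
  point lies in the range, and its preimage is below the given point.
\<close>

lemma munn_semigroup_subset_partial_homeomorphisms:
  assumes "lower_semilattice L"
  shows "carrier (munn_semigroup L) \<subseteq> carrier (partial_homeomorphisms (principal_ideal_topology L))"
proof
  interpret lower_semilattice L by fact
  let ?X = "principal_ideal_topology L"
  have image: "openin ?X (partial_image f U)"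
    if f: "f \<in> carrier (munn_semigroup L)" and "openin ?X U" for f U
    unfolding openin_principal_ideal_topology_iff[OF assms]
  proof (intro conjI ballI impI)
    have U: "z \<in> U" if "w \<in> U" "z \<in> carrier L" "z \<sqsubseteq>\<^bsub>L\<^esub> w" for w z
      using that \<open>openin ?X U\<close> openin_principal_ideal_topology_iff[OF assms] by blast
    show "partial_image f U \<subseteq> carrier L"
      using f by (auto simp: munn_semigroup_iff partial_image_def ran_def)
    fix y y' assume "y \<in> partial_image f U" "y' \<in> carrier L" "y' \<sqsubseteq>\<^bsub>L\<^esub> y"
    then obtain x where x: "x \<in> U" "f x = Some y" by (auto simp: partial_image_def)
    obtain e where e: "e \<in> carrier L" "ran f = principal_ideal L e"
      using f by (auto simp: munn_semigroup_iff)
    have "y \<in> principal_ideal L e" using e x by (metis ranI)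
    then have "y' \<in> ran f"
      using e \<open>y' \<in> carrier L\<close> \<open>y' \<sqsubseteq>\<^bsub>L\<^esub> y\<close> le_trans by (auto simp: principal_ideal_def)
    then obtain x' where x': "f x' = Some y'" by (auto simp: ran_def)
    then have "x' \<sqsubseteq>\<^bsub>L\<^esub> x" "x' \<in> carrier L"
      using f x \<open>y' \<sqsubseteq>\<^bsub>L\<^esub> y\<close> unfolding munn_semigroup_iff by blast+
    then show "y' \<in> partial_image f U" using U x x' by (auto simp: partial_image_def)
  qed
  fix f assume f: "f \<in> carrier (munn_semigroup L)"
  show "f \<in> carrier (partial_homeomorphisms ?X)"
    unfolding partial_homeomorphisms_iff topspace_principal_ideal_topology[OF assms]
    using f image[OF f] image[OF partial_inverse_in_munn_semigroup[OF f]]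
    by (auto simp: munn_semigroup_iff)
qed


section \<open>Conjugation of idempotents\<close>

context inverse_semigroup
begin

abbreviation inverse_of :: "'a \<Rightarrow> 'a" (\<open>_\<^sup>\<star>\<close> [1000] 1000) where
  "s\<^sup>\<star> \<equiv> sinv S s"

lemma sinv:
  assumes "s \<in> carrier S"
  shows sinv_closed: "s\<^sup>\<star> \<in> carrier S"
    and sinv_left: "s \<cdot> s\<^sup>\<star> \<cdot> s = s" and sinv_right: "s\<^sup>\<star> \<cdot> s \<cdot> s\<^sup>\<star> = s\<^sup>\<star>"
  using theI'[OF unique_inverse[OF assms]] by (auto simp: sinv_def)

lemma sinv_cancel:
  assumes "s \<in> carrier S"
  shows "s \<cdot> (s\<^sup>\<star> \<cdot> s) = s" "s\<^sup>\<star> \<cdot> (s \<cdot> s\<^sup>\<star>) = s\<^sup>\<star>"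
    and "z \<in> carrier S \<Longrightarrow> s \<cdot> (s\<^sup>\<star> \<cdot> (s \<cdot> z)) = s \<cdot> z"
    and "z \<in> carrier S \<Longrightarrow> s\<^sup>\<star> \<cdot> (s \<cdot> (s\<^sup>\<star> \<cdot> z)) = s\<^sup>\<star> \<cdot> z"
  using sinv[OF assms] assms assoc closed by metis+

lemma sinv_eqI:
  assumes "s \<in> carrier S" "t \<in> carrier S" "s \<cdot> t \<cdot> s = s" "t \<cdot> s \<cdot> t = t"
  shows "s\<^sup>\<star> = t"
  using inverse_eqI[OF assms(1) sinv_closed[OF assms(1)]] assms sinv by simp

lemma sinv_sinv: "s \<in> carrier S \<Longrightarrow> s\<^sup>\<star>\<^sup>\<star> = s"
  by (rule sinv_eqI) (auto simp: sinv)

lemma idempotentD: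
  assumes "e \<in> idempotents S"
  shows "e \<in> carrier S" "e \<cdot> e = e" "z \<in> carrier S \<Longrightarrow> e \<cdot> (e \<cdot> z) = e \<cdot> z" "e\<^sup>\<star> = e"
proof -
  show c: "e \<in> carrier S" and i: "e \<cdot> e = e" using assms by (auto simp: idempotents_def)
  show "e \<cdot> (e \<cdot> z) = e \<cdot> z" if "z \<in> carrier S" using assoc[OF c c that] i by simp
  show "e\<^sup>\<star> = e" by (rule sinv_eqI) (auto simp: c i)
qed

lemma sinv_mult_idempotent:
  assumes "s \<in> carrier S"
  shows "s\<^sup>\<star> \<cdot> s \<in> idempotents S" "s \<cdot> s\<^sup>\<star> \<in> idempotents S"
  using assms by (auto simp: idempotents_def closed sinv_closed assoc sinv_cancel)

lemma sinv_mult: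
  assumes s: "s \<in> carrier S" and t: "t \<in> carrier S"
  shows "(s \<cdot> t)\<^sup>\<star> = t\<^sup>\<star> \<cdot> s\<^sup>\<star>"
proof (rule sinv_eqI)
  note [simp] = s t sinv_closed closed assoc sinv_cancel
  let ?e = "s\<^sup>\<star> \<cdot> s" and ?f = "t \<cdot> t\<^sup>\<star>"
  have comm: "?e \<cdot> ?f = ?f \<cdot> ?e"
    by (rule idempotents_commute) (auto intro: sinv_mult_idempotent simp del: assoc)
  have "s \<cdot> t \<cdot> (t\<^sup>\<star> \<cdot> s\<^sup>\<star>) \<cdot> (s \<cdot> t) = s \<cdot> (?f \<cdot> ?e) \<cdot> t" by simp
  also have "\<dots> = s \<cdot> t" unfolding comm[symmetric] by simp
  finally show "s \<cdot> t \<cdot> (t\<^sup>\<star> \<cdot> s\<^sup>\<star>) \<cdot> (s \<cdot> t) = s \<cdot> t" .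
  have "t\<^sup>\<star> \<cdot> s\<^sup>\<star> \<cdot> (s \<cdot> t) \<cdot> (t\<^sup>\<star> \<cdot> s\<^sup>\<star>) = t\<^sup>\<star> \<cdot> (?e \<cdot> ?f) \<cdot> s\<^sup>\<star>" by simp
  also have "\<dots> = t\<^sup>\<star> \<cdot> s\<^sup>\<star>" unfolding comm by simp
  finally show "t\<^sup>\<star> \<cdot> s\<^sup>\<star> \<cdot> (s \<cdot> t) \<cdot> (t\<^sup>\<star> \<cdot> s\<^sup>\<star>) = t\<^sup>\<star> \<cdot> s\<^sup>\<star>" .
qed (use s t in \<open>auto intro: closed sinv_closed\<close>)

lemma idempotent_order_simps [simp]:
  "carrier (idempotent_order S) = idempotents S"
  "e \<in> idempotents S \<Longrightarrow> f \<in> idempotents S \<Longrightarrow> e \<sqsubseteq>\<^bsub>idempotent_order S\<^esub> f \<longleftrightarrow> e \<cdot> f = e"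
  using idempotents_commute[of e f] by (auto simp: idempotent_order_def)

text \<open>
  The inner factor \<open>s\<^sup>\<star> \<cdot> s\<close> commutes with idempotents and is absorbed by \<open>s\<close>. The identity
  makes conjugation preserve idempotents (take \<open>x = y\<close>) and their order (take \<open>x \<cdot> y = x\<close>).
\<close>

lemma conj_mult:
  assumes s: "s \<in> carrier S" and x: "x \<in> idempotents S" and y: "y \<in> idempotents S"
  shows "(s \<cdot> x \<cdot> s\<^sup>\<star>) \<cdot> (s \<cdot> y \<cdot> s\<^sup>\<star>) = s \<cdot> (x \<cdot> y) \<cdot> s\<^sup>\<star>"
proof -
  note [simp] = s idempotentD(1)[OF x] idempotentD(1)[OF y] sinv_closed closed assoc sinv_cancel
  have "(s \<cdot> x \<cdot> s\<^sup>\<star>) \<cdot> (s \<cdot> y \<cdot> s\<^sup>\<star>) = s \<cdot> (x \<cdot> (s\<^sup>\<star> \<cdot> s)) \<cdot> (y \<cdot> s\<^sup>\<star>)" by simp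
  also have "\<dots> = s \<cdot> ((s\<^sup>\<star> \<cdot> s) \<cdot> x) \<cdot> (y \<cdot> s\<^sup>\<star>)"
    using idempotents_commute[OF x sinv_mult_idempotent(1)[OF s]] by (simp only:)
  finally show ?thesis by simp
qed

lemma conj_idempotent:
  assumes "s \<in> carrier S" "x \<in> idempotents S"
  shows "s \<cdot> x \<cdot> s\<^sup>\<star> \<in> idempotents S"
  using conj_mult[OF assms(1,2,2)] assms idempotentD[OF assms(2)]
  by (simp add: idempotents_def closed sinv_closed)

lemma conj_below:
  assumes "s \<in> carrier S" "x \<in> idempotents S"
  shows "s \<cdot> x \<cdot> s\<^sup>\<star> \<cdot> (s \<cdot> s\<^sup>\<star>) = s \<cdot> x \<cdot> s\<^sup>\<star>"
  using assms idempotentD[OF assms(2)] by (simp add: assoc closed sinv_closed sinv_cancel)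

text \<open>
  Applied to \<open>s\<close> and to \<open>s\<^sup>\<star>\<close>, this makes the two conjugations mutually inverse between the
  principal ideals of \<open>s\<^sup>\<star> \<cdot> s\<close> and \<open>s \<cdot> s\<^sup>\<star>\<close>.
\<close>

lemma conj_conj_sinv:
  assumes s: "s \<in> carrier S" and x: "x \<in> idempotents S" and le: "x \<cdot> (s\<^sup>\<star> \<cdot> s) = x"
  shows "s\<^sup>\<star> \<cdot> (s \<cdot> x \<cdot> s\<^sup>\<star>) \<cdot> s = x"
proof -
  have "s\<^sup>\<star> \<cdot> (s \<cdot> x \<cdot> s\<^sup>\<star>) \<cdot> s = (s\<^sup>\<star> \<cdot> s) \<cdot> (x \<cdot> (s\<^sup>\<star> \<cdot> s))"
    using s idempotentD[OF x] by (simp add: assoc closed sinv_closed)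
  also have "\<dots> = x"
    using le idempotents_commute[OF x sinv_mult_idempotent(1)[OF s]] by simp
  finally show ?thesis .
qed


section \<open>The Munn representation\<close>

lemma munn_rep_eq_Some_iff:
  assumes "s \<in> carrier S"
  shows "munn_rep S s x = Some y \<longleftrightarrow>
    x \<in> idempotents S \<and> x \<cdot> (s\<^sup>\<star> \<cdot> s) = x \<and> y = s \<cdot> x \<cdot> s\<^sup>\<star>"
  using sinv_mult_idempotent[OF assms] by (auto simp: munn_rep_def principal_ideal_def)

lemma munn_rep_sinv:
  assumes "s \<in> carrier S"
  shows "munn_rep S s x = Some y \<longleftrightarrow> munn_rep S s\<^sup>\<star> y = Some x"
proof -
  have "munn_rep S t\<^sup>\<star> v = Some u" if "t \<in> carrier S" "munn_rep S t u = Some v" for t u v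
    using that conj_idempotent[OF that(1), of u] conj_below[OF that(1), of u]
      conj_conj_sinv[OF that(1), of u]
    by (simp add: munn_rep_eq_Some_iff sinv_closed sinv_sinv)
  then show ?thesis using assms sinv_closed sinv_sinv by metis
qed

lemma partial_inverse_munn_rep:
  assumes "s \<in> carrier S"
  shows "inj_on (munn_rep S s) (dom (munn_rep S s))"
    and "partial_inverse (munn_rep S s) = munn_rep S s\<^sup>\<star>"
  by (rule partial_inverseI, rule munn_rep_sinv[OF assms])+

lemma dom_munn_rep:
  "dom (munn_rep S s) = principal_ideal (idempotent_order S) (s\<^sup>\<star> \<cdot> s)"
  by (auto simp: munn_rep_def split: if_splits)

lemma ran_munn_rep:
  assumes "s \<in> carrier S"
  shows "ran (munn_rep S s) = principal_ideal (idempotent_order S) (s \<cdot> s\<^sup>\<star>)"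
  using dom_munn_rep[of "s\<^sup>\<star>"] dom_partial_inverse[of "munn_rep S s"]
    partial_inverse_munn_rep(2)[OF assms] sinv_sinv[OF assms] by simp

lemma munn_rep_in_munn_semigroup:
  assumes s: "s \<in> carrier S"
  shows "munn_rep S s \<in> carrier (munn_semigroup (idempotent_order S))"
proof -
  have mono: "x' \<cdot> y' = x'"
    if "t \<in> carrier S" "munn_rep S t x = Some x'" "munn_rep S t y = Some y'" "x \<cdot> y = x" for t x y x' y'
    using that conj_mult[OF that(1), of x y] by (simp add: munn_rep_eq_Some_iff)
  have val: "x \<in> idempotents S" "y \<in> idempotents S" if "munn_rep S s x = Some y" for x y
    using that conj_idempotent[OF s] by (auto simp: munn_rep_eq_Some_iff[OF s])
  have "x \<cdot> y = x \<longleftrightarrow> x' \<cdot> y' = x'"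
    if "munn_rep S s x = Some x'" "munn_rep S s y = Some y'" for x y x' y'
    using that mono[OF s] mono[OF sinv_closed[OF s]] munn_rep_sinv[OF s] by blast
  then have "\<forall>x y x' y'. munn_rep S s x = Some x' \<longrightarrow> munn_rep S s y = Some y' \<longrightarrow>
      (x \<sqsubseteq>\<^bsub>idempotent_order S\<^esub> y \<longleftrightarrow> x' \<sqsubseteq>\<^bsub>idempotent_order S\<^esub> y')"
    using val by simp
  moreover have "dom (munn_rep S s) \<subseteq> idempotents S" "ran (munn_rep S s) \<subseteq> idempotents S"
    using val by (auto simp: ran_def)
  ultimately show ?thesis
    unfolding munn_semigroup_iff idempotent_order_simps(1)
    using dom_munn_rep[of s] ran_munn_rep[OF s] sinv_mult_idempotent[OF s]
      partial_inverse_munn_rep(1)[OF s] by blast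
qed

text \<open>
  The domain of the composite of two maps of the representation consists of the
  \<open>x \<le> t\<^sup>\<star> \<cdot> t\<close> whose conjugate lies below \<open>s\<^sup>\<star> \<cdot> s\<close>; this adjunction, with \<open>e = s\<^sup>\<star> \<cdot> s\<close>,
  identifies it with the domain belonging to the product \<open>s \<cdot> t\<close>.
\<close>

lemma below_conj_iff:
  assumes t: "t \<in> carrier S" and x: "x \<in> idempotents S" and e: "e \<in> idempotents S"
  shows "x \<cdot> (t\<^sup>\<star> \<cdot> e \<cdot> t) = x \<longleftrightarrow> x \<cdot> (t\<^sup>\<star> \<cdot> t) = x \<and> t \<cdot> x \<cdot> t\<^sup>\<star> \<cdot> e = t \<cdot> x \<cdot> t\<^sup>\<star>"
    (is "?L \<longleftrightarrow> ?R")
proof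
  note [simp] = t idempotentD[OF x] idempotentD[OF e] sinv_closed closed assoc sinv_cancel
  {
    assume L: ?L
    have "x \<cdot> (t\<^sup>\<star> \<cdot> t) = x \<cdot> (t\<^sup>\<star> \<cdot> e \<cdot> t) \<cdot> (t\<^sup>\<star> \<cdot> t)" using L by (simp only:)
    also have "\<dots> = x \<cdot> (t\<^sup>\<star> \<cdot> e \<cdot> t)" by simp
    finally have 1: "x \<cdot> (t\<^sup>\<star> \<cdot> t) = x" using L by (simp only:)
    have "t \<cdot> x \<cdot> t\<^sup>\<star> = t \<cdot> (x \<cdot> (t\<^sup>\<star> \<cdot> e \<cdot> t)) \<cdot> t\<^sup>\<star>" using L by (simp only:)
    also have "\<dots> = t \<cdot> x \<cdot> t\<^sup>\<star> \<cdot> (e \<cdot> (t \<cdot> t\<^sup>\<star>))" by simp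
    also have "\<dots> = t \<cdot> x \<cdot> t\<^sup>\<star> \<cdot> ((t \<cdot> t\<^sup>\<star>) \<cdot> e)"
      using idempotents_commute[OF e sinv_mult_idempotent(2)[OF t]] by (simp only:)
    also have "\<dots> = t \<cdot> x \<cdot> t\<^sup>\<star> \<cdot> e" by simp
    finally show ?R using 1 by (simp only:)
  next
    assume R: ?R
    have xt: "t\<^sup>\<star> \<cdot> t \<cdot> x = x"
      using R idempotents_commute[OF x sinv_mult_idempotent(1)[OF t]] by (simp only:)
    have "x \<cdot> (t\<^sup>\<star> \<cdot> e \<cdot> t) = (t\<^sup>\<star> \<cdot> t \<cdot> x) \<cdot> (t\<^sup>\<star> \<cdot> e \<cdot> t)" using xt by (simp only:)
    also have "\<dots> = t\<^sup>\<star> \<cdot> (t \<cdot> x \<cdot> t\<^sup>\<star> \<cdot> e) \<cdot> t" by simp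
    also have "\<dots> = t\<^sup>\<star> \<cdot> (t \<cdot> x \<cdot> t\<^sup>\<star>) \<cdot> t" using R by (simp only:)
    also have "\<dots> = x" by (rule conj_conj_sinv) (use t x R in auto)
    finally show ?L .
  }
qed

lemma munn_rep_mult:
  assumes s: "s \<in> carrier S" and t: "t \<in> carrier S"
  shows "munn_rep S (s \<cdot> t) = munn_rep S s \<circ>\<^sub>m munn_rep S t"
proof -
  have "munn_rep S (s \<cdot> t) x = Some y \<longleftrightarrow> (munn_rep S s \<circ>\<^sub>m munn_rep S t) x = Some y" for x y
  proof (cases "x \<in> idempotents S")
    case x: True
    note [simp] = s t idempotentD(1)[OF x] sinv_closed closed assoc
    have dom: "x \<cdot> ((s \<cdot> t)\<^sup>\<star> \<cdot> (s \<cdot> t)) = x \<longleftrightarrow>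
        x \<cdot> (t\<^sup>\<star> \<cdot> t) = x \<and> t \<cdot> x \<cdot> t\<^sup>\<star> \<cdot> (s\<^sup>\<star> \<cdot> s) = t \<cdot> x \<cdot> t\<^sup>\<star>"
      using below_conj_iff[OF t x sinv_mult_idempotent(1)[OF s]] by (simp add: sinv_mult)
    have val: "s \<cdot> t \<cdot> x \<cdot> (s \<cdot> t)\<^sup>\<star> = s \<cdot> (t \<cdot> x \<cdot> t\<^sup>\<star>) \<cdot> s\<^sup>\<star>"
      by (simp add: sinv_mult)
    show ?thesis
      unfolding map_comp_Some_iff munn_rep_eq_Some_iff[OF closed[OF s t]]
        munn_rep_eq_Some_iff[OF s] munn_rep_eq_Some_iff[OF t] dom val
      using x conj_idempotent[OF t x] by blast
  qed (auto simp: map_comp_Some_iff munn_rep_eq_Some_iff s t closed)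
  then show ?thesis by (metis ext not_Some_eq)
qed

text \<open>The domain of the map of an idempotent \<open>e\<close> has \<open>e\<close> as its greatest element.\<close>

lemma munn_rep_idempotent_separating: "idempotent_separating S (munn_rep S)"
  unfolding idempotent_separating_def
proof (rule inj_onI)
  fix e f assume e: "e \<in> idempotents S" and f: "f \<in> idempotents S"
    and eq: "munn_rep S e = munn_rep S f"
  have dom: "dom (munn_rep S g) = {x \<in> idempotents S. x \<cdot> g = x}" if "g \<in> idempotents S" for g
    using that idempotentD[OF that] by (auto simp: dom_munn_rep principal_ideal_def)
  have "e \<cdot> f = e" "f \<cdot> e = f"
    using dom[OF e] dom[OF f] eq e f idempotentD by auto
  then show "e = f" using idempotents_commute[OF e f] by simp
qed


section \<open>The centralizer of the idempotents\<close>

lemma centralizerD: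
  assumes "s \<in> centralizer_of_idempotents S"
  shows "s \<in> carrier S" "e \<in> idempotents S \<Longrightarrow> s \<cdot> e = e \<cdot> s"
  using assms by (auto simp: centralizer_of_idempotents_def)

lemma idempotents_subset_centralizer: "idempotents S \<subseteq> centralizer_of_idempotents S"
  using idempotents_commute by (auto simp: centralizer_of_idempotents_def idempotents_def)

text \<open>
  Since \<open>s\<close> commutes with the idempotents \<open>s\<^sup>\<star> \<cdot> s\<close> and \<open>s \<cdot> s\<^sup>\<star>\<close>, each of them turns out to lie
  below the other.
\<close>

lemma centralizer_sinv_commute:
  assumes s: "s \<in> centralizer_of_idempotents S"
  shows "s \<cdot> s\<^sup>\<star> = s\<^sup>\<star> \<cdot> s"
proof -
  note c = centralizerD(1)[OF s]
  note [simp] = c sinv_closed closed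
  let ?l = "s\<^sup>\<star> \<cdot> s" and ?r = "s \<cdot> s\<^sup>\<star>"
  have "?l \<cdot> ?r = (?l \<cdot> s) \<cdot> s\<^sup>\<star>" by (simp add: assoc)
  also have "\<dots> = (s \<cdot> ?l) \<cdot> s\<^sup>\<star>"
    using centralizerD(2)[OF s sinv_mult_idempotent(1)[OF c]] by (simp only:)
  also have "\<dots> = ?r" by (simp add: assoc sinv_cancel)
  finally have 1: "?l \<cdot> ?r = ?r" .
  have "?l \<cdot> ?r = s\<^sup>\<star> \<cdot> (s \<cdot> ?r)" by (simp add: assoc)
  also have "\<dots> = s\<^sup>\<star> \<cdot> (?r \<cdot> s)"
    using centralizerD(2)[OF s sinv_mult_idempotent(2)[OF c]] by (simp only:)
  also have "\<dots> = ?l" by (simp add: assoc sinv_cancel)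
  finally show ?thesis using 1 by simp
qed

lemma centralizer_mult_closed:
  assumes "s \<in> centralizer_of_idempotents S" "t \<in> centralizer_of_idempotents S"
  shows "s \<cdot> t \<in> centralizer_of_idempotents S"
proof -
  have "s \<cdot> t \<cdot> e = e \<cdot> (s \<cdot> t)" if "e \<in> idempotents S" for e
  proof -
    note c = assms[THEN centralizerD(1)] idempotentD(1)[OF that]
    have "s \<cdot> t \<cdot> e = s \<cdot> (e \<cdot> t)"
      using centralizerD(2)[OF assms(2) that] c by (simp add: assoc)
    also have "\<dots> = (s \<cdot> e) \<cdot> t" using c by (simp add: assoc)
    also have "\<dots> = e \<cdot> (s \<cdot> t)"
      using centralizerD(2)[OF assms(1) that] c by (simp add: assoc)
    finally show ?thesis .
  qed
  then show ?thesis
    using assms[THEN centralizerD(1)] by (simp add: centralizer_of_idempotents_def closed)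
qed

lemma centralizer_sinv_closed:
  assumes s: "s \<in> centralizer_of_idempotents S"
  shows "s\<^sup>\<star> \<in> centralizer_of_idempotents S"
proof -
  note c = centralizerD(1)[OF s]
  have "s\<^sup>\<star> \<cdot> e = e \<cdot> s\<^sup>\<star>" if e: "e \<in> idempotents S" for e
  proof -
    note [simp] = c sinv_closed closed idempotentD(1)[OF e]
    have "s\<^sup>\<star> \<cdot> e = s\<^sup>\<star> \<cdot> ((s \<cdot> s\<^sup>\<star>) \<cdot> e)" by (simp add: assoc sinv_cancel)
    also have "\<dots> = s\<^sup>\<star> \<cdot> (e \<cdot> (s \<cdot> s\<^sup>\<star>))"
      using idempotents_commute[OF e sinv_mult_idempotent(2)[OF c]] by (simp only:)
    also have "\<dots> = s\<^sup>\<star> \<cdot> ((e \<cdot> s) \<cdot> s\<^sup>\<star>)" by (simp add: assoc)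
    also have "\<dots> = s\<^sup>\<star> \<cdot> ((s \<cdot> e) \<cdot> s\<^sup>\<star>)" using centralizerD(2)[OF s e] by (simp only:)
    also have "\<dots> = ((s\<^sup>\<star> \<cdot> s) \<cdot> e) \<cdot> s\<^sup>\<star>" by (simp add: assoc)
    also have "\<dots> = (e \<cdot> (s\<^sup>\<star> \<cdot> s)) \<cdot> s\<^sup>\<star>"
      using idempotents_commute[OF e sinv_mult_idempotent(1)[OF c]] by (simp only:)
    also have "\<dots> = e \<cdot> s\<^sup>\<star>" by (simp add: assoc sinv_cancel)
    finally show ?thesis .
  qed
  then show ?thesis using sinv_closed[OF c] by (simp add: centralizer_of_idempotents_def)
qed

lemma inverse_semigroup_restrict:
  assumes H: "H \<subseteq> carrier S" "H \<noteq> {}"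
    and mult: "\<And>x y. x \<in> H \<Longrightarrow> y \<in> H \<Longrightarrow> x \<cdot> y \<in> H"
    and inv: "\<And>x. x \<in> H \<Longrightarrow> x\<^sup>\<star> \<in> H"
  shows "inverse_semigroup (S\<lparr>carrier := H\<rparr>)"
proof
  fix s assume s: "s \<in> carrier (S\<lparr>carrier := H\<rparr>)"
  then have "s \<in> H" "s \<in> carrier S" using H by auto
  then show "\<exists>!t. t \<in> carrier (S\<lparr>carrier := H\<rparr>) \<and>
      s = s \<cdot>\<^bsub>S\<lparr>carrier := H\<rparr>\<^esub> t \<cdot>\<^bsub>S\<lparr>carrier := H\<rparr>\<^esub> s \<and> t = t \<cdot>\<^bsub>S\<lparr>carrier := H\<rparr>\<^esub> s \<cdot>\<^bsub>S\<lparr>carrier := H\<rparr>\<^esub> t"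
    using inv[of s] sinv[of s] sinv_eqI[of s, symmetric] subsetD[OF H(1)]
    by (intro ex1I[of _ "s\<^sup>\<star>"]) simp_all
qed (use H(2) mult subsetD[OF H(1)] in \<open>auto simp: assoc\<close>)

text \<open>
  An idempotent partial bijection is the identity on its domain, so the Kernel consists of the
  \<open>s\<close> with \<open>s \<cdot> x \<cdot> s\<^sup>\<star> = x\<close> for all \<open>x \<le> s\<^sup>\<star> \<cdot> s\<close>. At \<open>x = s\<^sup>\<star> \<cdot> s\<close> this says that
  \<open>s\<close> commutes with its inverse. For an arbitrary idempotent \<open>e\<close>, taking
  \<open>x = s\<^sup>\<star> \<cdot> s \<cdot> e\<close> then gives \<open>s \<cdot> e = e \<cdot> s\<close>.
\<close>

lemma munn_rep_idempotent_iff: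
  assumes s: "s \<in> carrier S"
  shows "munn_rep S s \<circ>\<^sub>m munn_rep S s = munn_rep S s \<longleftrightarrow> s \<in> centralizer_of_idempotents S"
proof
  assume idem: "munn_rep S s \<circ>\<^sub>m munn_rep S s = munn_rep S s"
  have fixed: "s \<cdot> x \<cdot> s\<^sup>\<star> = x" if "x \<in> idempotents S" "x \<cdot> (s\<^sup>\<star> \<cdot> s) = x" for x
  proof -
    define y where "y = s \<cdot> x \<cdot> s\<^sup>\<star>"
    have y: "munn_rep S s x = Some y"
      using that by (simp add: munn_rep_eq_Some_iff[OF s] y_def)
    then have "munn_rep S s y = Some y"
      using fun_cong[OF idem, of x] by (simp add: map_comp_def)
    from inj_on_dom_eqI[OF partial_inverse_munn_rep(1)[OF s] this y] show ?thesis
      by (simp add: y_def)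
  qed
  let ?l = "s\<^sup>\<star> \<cdot> s"
  note l = sinv_mult_idempotent(1)[OF s]
  have comm: "s \<cdot> s\<^sup>\<star> = ?l"
    using fixed[OF l] s idempotentD[OF l] by (simp add: assoc closed sinv_closed sinv_cancel)
  have "s \<cdot> e = e \<cdot> s" if e: "e \<in> idempotents S" for e
  proof -
    note [simp] = s sinv_closed closed idempotentD(1)[OF e]
    have le: "?l \<cdot> e = e \<cdot> ?l" by (rule idempotents_commute[OF l e])
    have x: "?l \<cdot> e \<in> idempotents S" by (rule idempotent_mult_closed[OF l e])
    have xl: "?l \<cdot> e \<cdot> ?l = ?l \<cdot> e"
      unfolding le by (simp add: assoc sinv_cancel)
    have "s \<cdot> e = s \<cdot> (?l \<cdot> e)" by (simp add: assoc sinv_cancel)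
    also have "\<dots> = s \<cdot> (?l \<cdot> e \<cdot> ?l)" using xl by (simp only:)
    also have "\<dots> = (s \<cdot> (?l \<cdot> e) \<cdot> s\<^sup>\<star>) \<cdot> s" by (simp add: assoc)
    also have "\<dots> = (e \<cdot> ?l) \<cdot> s" using fixed[OF x xl] le by (simp only:)
    also have "\<dots> = e \<cdot> (s \<cdot> s\<^sup>\<star>) \<cdot> s" by (simp only: comm)
    also have "\<dots> = e \<cdot> s" by (simp add: assoc sinv_cancel)
    finally show ?thesis .
  qed
  then show "s \<in> centralizer_of_idempotents S" using s by (simp add: centralizer_of_idempotents_def)
next
  assume z: "s \<in> centralizer_of_idempotents S"
  have "munn_rep S s x = Some y \<Longrightarrow> y = x" for x y
    using centralizerD(2)[OF z, of x] centralizer_sinv_commute[OF z] s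
    by (auto simp: munn_rep_eq_Some_iff assoc sinv_closed idempotentD)
  then show "munn_rep S s \<circ>\<^sub>m munn_rep S s = munn_rep S s"
    by (intro ext) (simp add: map_comp_def split: option.split, metis)
qed


section \<open>The centralizer as a presheaf of groups\<close>

text \<open>
  This is the class of \<open>e\<close> under Green's relation H of the centralizer. The condition
  \<open>s \<cdot> s\<^sup>\<star> = e\<close> follows from \<open>s\<^sup>\<star> \<cdot> s = e\<close>, as elements of the centralizer commute with their inverses.
\<close>

definition component_group :: "'a \<Rightarrow> 'a monoid" where
  "component_group e =
     \<lparr>carrier = {s \<in> centralizer_of_idempotents S. s\<^sup>\<star> \<cdot> s = e}, monoid.mult = sg_mult S, one = e\<rparr>"

lemma component_group_simps [simp]:
  "s \<in> carrier (component_group e) \<longleftrightarrow> s \<in> centralizer_of_idempotents S \<and> s\<^sup>\<star> \<cdot> s = e"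
  "monoid.mult (component_group e) = sg_mult S" "one (component_group e) = e"
  by (auto simp: component_group_def)

lemma centralizer_source_mult:
  assumes "s \<in> centralizer_of_idempotents S" "t \<in> centralizer_of_idempotents S"
  shows "(s \<cdot> t)\<^sup>\<star> \<cdot> (s \<cdot> t) = (s\<^sup>\<star> \<cdot> s) \<cdot> (t\<^sup>\<star> \<cdot> t)"
proof -
  note c = assms[THEN centralizerD(1)]
  note [simp] = c sinv_closed closed
  have "(s \<cdot> t)\<^sup>\<star> \<cdot> (s \<cdot> t) = t\<^sup>\<star> \<cdot> ((s\<^sup>\<star> \<cdot> s) \<cdot> t)" by (simp add: sinv_mult assoc)
  also have "\<dots> = t\<^sup>\<star> \<cdot> (t \<cdot> (s\<^sup>\<star> \<cdot> s))"
    using centralizerD(2)[OF assms(2) sinv_mult_idempotent(1)[OF c(1)]] by (simp only:)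
  also have "\<dots> = (t\<^sup>\<star> \<cdot> t) \<cdot> (s\<^sup>\<star> \<cdot> s)" by (simp add: assoc)
  also have "\<dots> = (s\<^sup>\<star> \<cdot> s) \<cdot> (t\<^sup>\<star> \<cdot> t)"
    by (intro idempotents_commute sinv_mult_idempotent c)
  finally show ?thesis .
qed

lemma group_component_group:
  assumes e: "e \<in> idempotents S"
  shows "group (component_group e)"
proof (rule groupI)
  fix x y assume "x \<in> carrier (component_group e)" "y \<in> carrier (component_group e)"
  then show "x \<otimes>\<^bsub>component_group e\<^esub> y \<in> carrier (component_group e)"
    using idempotentD(2)[OF e] by (simp add: centralizer_mult_closed centralizer_source_mult)
next
  show "\<one>\<^bsub>component_group e\<^esub> \<in> carrier (component_group e)"
    using e idempotents_subset_centralizer idempotentD[OF e] by auto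
next
  fix x assume x: "x \<in> carrier (component_group e)"
  then have z: "x \<in> centralizer_of_idempotents S" and xe: "x\<^sup>\<star> \<cdot> x = e" by auto
  have "e \<cdot> x = x"
    using centralizer_sinv_commute[OF z] xe sinv_left[OF centralizerD(1)[OF z]] by simp
  then show "\<one>\<^bsub>component_group e\<^esub> \<otimes>\<^bsub>component_group e\<^esub> x = x" by simp
  have "x\<^sup>\<star> \<in> carrier (component_group e)"
    using z xe centralizer_sinv_closed[OF z] centralizer_sinv_commute[OF z]
      sinv_sinv[OF centralizerD(1)[OF z]] by simp
  then show "\<exists>y\<in>carrier (component_group e). y \<otimes>\<^bsub>component_group e\<^esub> x = \<one>\<^bsub>component_group e\<^esub>"
    using xe by auto
qed (auto simp: assoc centralizerD)

lemma presheaf_of_component_groups: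
  "presheaf_of_groups (idempotent_order S) component_group (\<lambda>e f x. x \<cdot> f)"
proof (intro presheaf_of_groups.intro presheaf_of_groups_axioms.intro
    lower_semilattice_idempotents)
  fix e assume "e \<in> carrier (idempotent_order S)"
  then show "group (component_group e)" by (simp add: group_component_group)
next
  fix e f assume "e \<in> carrier (idempotent_order S)" "f \<in> carrier (idempotent_order S)" "e \<noteq> f"
  then show "carrier (component_group e) \<inter> carrier (component_group f) = {}" by auto
next
  fix e f assume "e \<in> carrier (idempotent_order S)" "f \<in> carrier (idempotent_order S)"
    "f \<sqsubseteq>\<^bsub>idempotent_order S\<^esub> e"
  then have e: "e \<in> idempotents S" and f: "f \<in> idempotents S" and fe: "e \<cdot> f = f"
    using idempotents_commute by auto
  have fz: "f \<in> centralizer_of_idempotents S" using f idempotents_subset_centralizer by auto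
  show "(\<lambda>x. x \<cdot> f) \<in> hom (component_group e) (component_group f)"
  proof (rule homI)
    fix x assume "x \<in> carrier (component_group e)"
    then show "x \<cdot> f \<in> carrier (component_group f)"
      using fz fe idempotentD[OF f] by (simp add: centralizer_mult_closed centralizer_source_mult)
  next
    fix x y assume "x \<in> carrier (component_group e)" "y \<in> carrier (component_group e)"
    then have x: "x \<in> carrier S" and y: "y \<in> carrier S" and yf: "y \<cdot> f = f \<cdot> y"
      using centralizerD f by auto
    have "x \<cdot> f \<cdot> (y \<cdot> f) = x \<cdot> (f \<cdot> (f \<cdot> y))"
      using x y idempotentD(1)[OF f] by (simp add: yf assoc closed)
    also have "\<dots> = x \<cdot> y \<cdot> f"
      using x y idempotentD[OF f] by (simp add: yf assoc closed)
    finally show "x \<otimes>\<^bsub>component_group e\<^esub> y \<cdot> f = x \<cdot> f \<otimes>\<^bsub>component_group f\<^esub> (y \<cdot> f)"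
      by simp
  qed
next
  fix e x assume "e \<in> carrier (idempotent_order S)" "x \<in> carrier (component_group e)"
  then show "x \<cdot> e = x" using sinv_cancel(1)[of x] centralizerD(1)[of x] by auto
next
  fix e f g x assume "e \<in> carrier (idempotent_order S)" "f \<in> carrier (idempotent_order S)"
    "g \<in> carrier (idempotent_order S)" "g \<sqsubseteq>\<^bsub>idempotent_order S\<^esub> f"
    "x \<in> carrier (component_group e)"
  then show "x \<cdot> f \<cdot> g = x \<cdot> g"
    using idempotents_commute[of f g] assoc centralizerD(1)[of x] idempotentD(1) by simp
qed

lemma meet_idempotent_order:
  assumes "e \<in> idempotents S" "f \<in> idempotents S"
  shows "e \<sqinter>\<^bsub>idempotent_order S\<^esub> f = e \<cdot> f"
proof -
  interpret lower_semilattice "idempotent_order S" by (rule lower_semilattice_idempotents)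
  have "greatest (idempotent_order S) (e \<sqinter>\<^bsub>idempotent_order S\<^esub> f) (Lower (idempotent_order S) {e, f})"
    using assms greatest_lower_bound[OF assms]
    unfolding meet_def inf_def by (metis someI)
  then show ?thesis using greatest_lower_bound[OF assms] greatest_unique by blast
qed

text \<open>
  With \<open>e = x\<^sup>\<star> \<cdot> x\<close> and \<open>f = y\<^sup>\<star> \<cdot> y\<close>, restricting both factors to \<open>e \<cdot> f\<close> leaves \<open>x \<cdot> y\<close> unchanged, because the idempotents move freely past
  \<open>x\<close> and \<open>y\<close>, where they are absorbed.
\<close>

lemma centralizer_iso_presheaf_semigroup:
  "id \<in> semigroup_iso (S\<lparr>carrier := centralizer_of_idempotents S\<rparr>)
     (presheaf_semigroup (idempotent_order S) component_group (\<lambda>e f x. x \<cdot> f))"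
    (is "id \<in> semigroup_iso ?K ?P")
proof -
  have idem: "s\<^sup>\<star> \<cdot> s \<in> idempotents S" if "s \<in> centralizer_of_idempotents S" for s
    using that sinv_mult_idempotent(1) centralizerD(1) by blast
  have carr: "carrier ?P = centralizer_of_idempotents S"
    using idem by (auto simp: presheaf_semigroup_def)
  have index: "presheaf_index (idempotent_order S) component_group s = s\<^sup>\<star> \<cdot> s"
    if "s \<in> centralizer_of_idempotents S" for s
    unfolding presheaf_index_def using that idem by (intro the_equality) auto
  have mult: "x \<cdot>\<^bsub>?P\<^esub> y = x \<cdot> y"
    if x: "x \<in> centralizer_of_idempotents S" and y: "y \<in> centralizer_of_idempotents S" for x y
  proof -
    define e f where "e = x\<^sup>\<star> \<cdot> x" and "f = y\<^sup>\<star> \<cdot> y"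
    have e: "e \<in> idempotents S" and f: "f \<in> idempotents S" using idem x y by (auto simp: e_def f_def)
    have ef: "e \<cdot> f \<in> idempotents S" by (rule idempotent_mult_closed[OF e f])
    note [simp] = centralizerD(1)[OF x] centralizerD(1)[OF y] idempotentD(1)[OF e]
      idempotentD(1)[OF f] closed sinv_closed
    have xe: "x \<cdot> e = x" and yf: "y \<cdot> f = y" by (simp_all add: e_def f_def sinv_cancel)
    have "x \<cdot>\<^bsub>?P\<^esub> y = x \<cdot> (e \<cdot> f) \<cdot> (y \<cdot> (e \<cdot> f))"
      using x y e f
      by (simp add: presheaf_semigroup_def Let_def index meet_idempotent_order flip: e_def f_def)
    also have "\<dots> = x \<cdot> ((e \<cdot> f) \<cdot> ((e \<cdot> f) \<cdot> y))"
      using centralizerD(2)[OF y ef] by (simp add: assoc)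
    also have "\<dots> = x \<cdot> ((e \<cdot> f) \<cdot> y)" using idempotentD(3)[OF ef] by simp
    also have "\<dots> = (x \<cdot> e) \<cdot> (f \<cdot> y)" by (simp add: assoc)
    also have "\<dots> = x \<cdot> y" using xe yf centralizerD(2)[OF y f] by simp
    finally show ?thesis .
  qed
  show ?thesis
    using carr mult by (auto simp: semigroup_iso_def semigroup_hom_def bij_betw_def)
qed

end


section \<open>The extension\<close>

theorem theorem4p12:
  fixes S :: "'a semigrp"
    and \<delta> :: "'a \<Rightarrow> ('a \<rightharpoonup> 'a)"
    and T :: "('a \<rightharpoonup> 'a) semigrp"
    and K :: "'a semigrp"
  assumes S: "inverse_semigroup S"
    and delta: "\<delta> = munn_rep S"
    and T: "T = (munn_semigroup (idempotent_order S))\<lparr>carrier := \<delta> ` carrier S\<rparr>"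
    and K: "K = S\<lparr>carrier := centralizer_of_idempotents S\<rparr>"
  shows "\<delta> \<in> semigroup_hom S (munn_semigroup (idempotent_order S))
    \<and> inverse_semigroup T
    \<and> \<delta> \<in> semigroup_hom S T \<and> \<delta> ` carrier S = carrier T
    \<and> idempotent_separating S \<delta>
    \<and> Kernel S T \<delta> = carrier K
    \<and> inverse_semigroup K
    \<and> (\<exists>(L :: 'a gorder) (G :: 'a \<Rightarrow> 'a monoid) \<phi>. presheaf_of_groups L G \<phi> \<and>
          semigroup_iso K (presheaf_semigroup L G \<phi>) \<noteq> {})
    \<and> inverse_subsemigroup T
          (partial_homeomorphisms (principal_ideal_topology (idempotent_order S)))"
proof -
  interpret inverse_semigroup S by (rule S)
  let ?M = "munn_semigroup (idempotent_order S)"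
  let ?\<Gamma> = "partial_homeomorphisms (principal_ideal_topology (idempotent_order S))"
  have mults: "sg_mult ?M = (\<circ>\<^sub>m)" "sg_mult T = (\<circ>\<^sub>m)" "sg_mult ?\<Gamma> = (\<circ>\<^sub>m)"
    by (simp_all add: T munn_semigroup_def symmetric_inverse_semigroup_def partial_homeomorphisms_def)
  have carrT: "carrier T = \<delta> ` carrier S" by (simp add: T)
  have hom: "\<delta> (s \<cdot>\<^bsub>S\<^esub> t) = \<delta> s \<circ>\<^sub>m \<delta> t" if "s \<in> carrier S" "t \<in> carrier S" for s t
    using munn_rep_mult that by (simp add: delta)
  have in_munn: "\<delta> s \<in> carrier ?M" if "s \<in> carrier S" for s
    using munn_rep_in_munn_semigroup that by (simp add: delta)
  have neT: "carrier T \<noteq> {}" using nonempty carrT by simp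
  have injT: "inj_on f (dom f)" if "f \<in> carrier T" for f
    using that partial_inverse_munn_rep(1) by (auto simp: carrT delta)
  have compT: "f \<circ>\<^sub>m g \<in> carrier T" if fg: "f \<in> carrier T" "g \<in> carrier T" for f g
  proof -
    obtain s t where "s \<in> carrier S" "t \<in> carrier S" "f = \<delta> s" "g = \<delta> t"
      using fg by (auto simp: carrT)
    then show ?thesis using hom[of s t] closed[of s t] by (metis carrT imageI)
  qed
  have invT: "partial_inverse f \<in> carrier T" if "f \<in> carrier T" for f
    using that partial_inverse_munn_rep(2) sinv_closed by (auto simp: carrT delta)
  have "\<delta> \<in> semigroup_hom S ?M" "\<delta> \<in> semigroup_hom S T"
    using hom in_munn mults carrT by (auto simp: semigroup_hom_def)
  moreover have "inverse_semigroup T"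
    by (rule inverse_semigroup_of_partial_bijections(1)) (fact mults neT injT compT invT)+
  moreover have "idempotent_separating S \<delta>"
    unfolding delta by (rule munn_rep_idempotent_separating)
  moreover have "Kernel S T \<delta> = carrier K"
  proof -
    have "s \<in> Kernel S T \<delta> \<longleftrightarrow> s \<in> centralizer_of_idempotents S" if "s \<in> carrier S" for s
      using that munn_rep_idempotent_iff[OF that] mults
      by (simp add: Kernel_def idempotents_def carrT delta)
    moreover have "Kernel S T \<delta> \<subseteq> carrier S" by (auto simp: Kernel_def)
    ultimately show ?thesis using centralizerD(1) by (auto simp: K)
  qed
  moreover have "inverse_semigroup K"
    unfolding K
  proof (rule inverse_semigroup_restrict)
    obtain s where "s \<in> carrier S" using nonempty by blast
    then show "centralizer_of_idempotents S \<noteq> {}"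
      using sinv_mult_idempotent(1) idempotents_subset_centralizer by blast
  qed (auto intro: centralizerD centralizer_mult_closed centralizer_sinv_closed)
  moreover have "\<exists>(L :: 'a gorder) (G :: 'a \<Rightarrow> 'a monoid) \<phi>. presheaf_of_groups L G \<phi> \<and>
      semigroup_iso K (presheaf_semigroup L G \<phi>) \<noteq> {}"
    using presheaf_of_component_groups centralizer_iso_presheaf_semigroup unfolding K by blast
  moreover have "inverse_subsemigroup T ?\<Gamma>"
  proof -
    have sub: "carrier T \<subseteq> carrier ?\<Gamma>"
      using munn_semigroup_subset_partial_homeomorphisms[OF lower_semilattice_idempotents] in_munn
      by (auto simp: carrT)
    have "sinv ?\<Gamma> f \<in> carrier T" if "f \<in> carrier T" for f
      using that sub invT partial_homeomorphisms_inverse_semigroup(2) by (metis subsetD)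
    then show ?thesis
      using sub neT compT mults partial_homeomorphisms_inverse_semigroup(1)
      by (simp add: inverse_subsemigroup_def)
  qed
  ultimately show ?thesis using carrT by blast
qed

end
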